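(* For $\alpha\in(0,1]$ let $C_{0,\alpha}:=\sup_{z\in\mathbb{C}\setminus\{0,1\}}\frac{\ln|1-z|}{|z|^{\alpha}}$. Then the following holds: (i) $C_{0,1}=1$. (ii) If $\alpha\in(0,1)$, then $$C_{0,\alpha}=\frac{1}{\alpha}\, r_\alpha^{\alpha}\,(1-r_\alpha)^{1-\alpha},$$ where $$r_\alpha=-\alpha\, W\!\left(-\frac1\alpha e^{-\frac1\alpha}\right)\in(0,\alpha).$$
   Context: $W:[-e^{-1},\infty)\to[-1,\infty)$ denotes the principal branch of the Lambert function, i.e. the inverse of the strictly increasing function $[-1,\infty)\ni x\mapsto xe^x\in[-e^{-1},\infty)$. *)

theory Defs
  imports Complex_Main "HOL-Library.Extended_Real"
begin

text \<open>The principal branch of the Lambert function. It is meaningful only for arguments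
  \<open>y \<ge> - exp (-1)\<close>, see \<open>bij_betw_times_exp\<close> below.\<close>

definition lambert_W :: "real \<Rightarrow> real" where
  "lambert_W = the_inv_into {-1..} (\<lambda>x. x * exp x)"

lemma strict_mono_on_times_exp: "strict_mono_on {-1..} (\<lambda>x::real. x * exp x)"
proof (rule strict_mono_onI)
  fix x y :: real
  assume x: "x \<in> {-1..}" and "y \<in> {-1..}" and xy: "x < y"
  show "x * exp x < y * exp y"
  proof (rule DERIV_pos_imp_increasing_open[OF xy])
    fix t assume t: "x < t" "t < y"
    have "((\<lambda>x. x * exp x) has_real_derivative (1 + t) * exp t) (at t)"
      by (auto intro!: derivative_eq_intros simp: algebra_simps)
    moreover have "(1 + t) * exp t > 0"
      using x t by simp
    ultimately show "\<exists>d. ((\<lambda>x. x * exp x) has_real_derivative d) (at t) \<and> d > 0"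
      by blast
  qed (auto intro!: continuous_intros)
qed

lemma bij_betw_times_exp: "bij_betw (\<lambda>x::real. x * exp x) {-1..} {- exp (-1)..}"
proof (rule bij_betwI')
  fix x y :: real
  assume "x \<in> {-1..}" "y \<in> {-1..}"
  then show "(x * exp x = y * exp y) = (x = y)"
    using strict_mono_on_eqD[OF strict_mono_on_times_exp] by metis
next
  fix x :: real
  assume "x \<in> {-1..}"
  then show "x * exp x \<in> {- exp (-1)..}"
    using strict_mono_on_leD[OF strict_mono_on_times_exp, of "-1" x] by simp
next
  fix y :: real
  assume y: "y \<in> {- exp (-1)..}"
  define b where "b = max 0 y"
  have "b * 1 \<le> b * exp b"
    by (rule mult_left_mono) (auto simp: b_def)
  then have "y \<le> b * exp b"
    by (simp add: b_def)
  moreover have "-1 * exp (-1) \<le> y" using y by simp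
  moreover have "-1 \<le> b" by (simp add: b_def)
  ultimately have "\<exists>x\<ge>-1. x \<le> b \<and> x * exp x = y"
    by (intro IVT') (auto intro!: continuous_intros)
  then show "\<exists>x\<in>{-1..}. y = x * exp x" by auto
qed

text \<open>The supremum is taken in the extended reals, so that an equation
  \<open>C0 \<alpha> = ereal c\<close> includes the finiteness of the supremum.\<close>

definition C0 :: "real \<Rightarrow> ereal" where
  "C0 \<alpha> = (SUP z \<in> UNIV - {0, 1 :: complex}. ereal (ln (cmod (1 - z)) / cmod z powr \<alpha>))"

definition r_of :: "real \<Rightarrow> real" where
  "r_of \<alpha> = - \<alpha> * lambert_W (- (1 / \<alpha>) * exp (- (1 / \<alpha>)))"

end

theory Submission
  imports Defs
begin

text \<open>
  On the circle \<open>cmod z = t\<close> the quantity \<open>cmod (1 - z)\<close> is largest at \<open>z = - t\<close>, so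
  \<open>C0 \<alpha>\<close> is the supremum of \<open>ln (1 + t) / t powr \<alpha>\<close> over \<open>t > 0\<close> (\<open>C0_eq_SUP_radius\<close>).
  For \<open>\<alpha> = 1\<close> the bounds \<open>t / (1 + t) \<le> ln (1 + t) \<le> t\<close> give the value 1, which is approached
  only as \<open>t\<close> tends to 0.

  For \<open>\<alpha> < 1\<close> the supremum is a maximum. Substituting \<open>x = 1 / (1 + t) \<in> {0<..<1}\<close> turns the
  function into \<open>- ln x * (x / (1 - x)) powr \<alpha>\<close>, whose logarithmic derivative is
  \<open>(\<alpha> * ln x + 1 - x) / (x * (1 - x) * ln x)\<close>. As \<open>ln x < 0\<close>, its sign is opposite to that of
  the concave function \<open>\<alpha> * ln x + 1 - x\<close>. The latter vanishes at 1 and has exactly one other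
  zero \<open>r\<close>, which lies to the left of its maximum point \<open>\<alpha>\<close>; hence the quotient increases up to
  \<open>r\<close> and decreases afterwards (\<open>log_radial_quotient_le\<close>, \<open>radial_quotient_le\<close>). The equation \<open>\<alpha> * ln r + 1 - r = 0\<close> says
  that \<open>w = - r / \<alpha>\<close> satisfies \<open>w * exp w = - (1 / \<alpha>) * exp (- (1 / \<alpha>))\<close>. The other solution
  \<open>w = - 1 / \<alpha> < - 1\<close> of this equation belongs to the zero 1, so the solution above \<open>- 1\<close>, on the
  principal branch, is the one that belongs to \<open>r\<close> (\<open>r_of_in_interval\<close>, \<open>r_of_equation\<close>).
  Finally, \<open>- ln r = (1 - r) / \<alpha>\<close> turns the maximum into the stated product of powers.
\<close>

section \<open>Reduction to a supremum over radii\<close>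

lemma C0_eq_SUP_radius:
  "C0 \<alpha> = (SUP t \<in> {0<..}. ereal (ln (1 + t) / t powr \<alpha>))"
proof (rule antisym)
  show "C0 \<alpha> \<le> (SUP t \<in> {0<..}. ereal (ln (1 + t) / t powr \<alpha>))"
    unfolding C0_def
  proof (rule SUP_mono)
    fix z :: complex
    assume z: "z \<in> UNIV - {0, 1}"
    have "cmod (1 - z) \<le> 1 + cmod z"
      using norm_triangle_ineq4[of 1 z] by simp
    then have "ln (cmod (1 - z)) \<le> ln (1 + cmod z)"
      using z by (intro ln_mono) auto
    then have "ln (cmod (1 - z)) / cmod z powr \<alpha> \<le> ln (1 + cmod z) / cmod z powr \<alpha>"
      by (intro divide_right_mono) auto
    then show "\<exists>t\<in>{0<..}. ereal (ln (cmod (1 - z)) / cmod z powr \<alpha>)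
        \<le> ereal (ln (1 + t) / t powr \<alpha>)"
      using z by (intro bexI[of _ "cmod z"]) auto
  qed
  show "(SUP t \<in> {0<..}. ereal (ln (1 + t) / t powr \<alpha>)) \<le> C0 \<alpha>"
    unfolding C0_def
  proof (rule SUP_mono)
    fix t :: real
    assume t: "t \<in> {0<..}"
    define z where "z = complex_of_real (- t)"
    have "cmod z = t"
      unfolding z_def norm_of_real using t by simp
    moreover have "1 - z = complex_of_real (1 + t)"
      by (simp add: z_def)
    then have "cmod (1 - z) = 1 + t"
      unfolding norm_of_real using t by (simp only: norm_of_real) simp
    moreover have "z \<in> UNIV - {0, 1}"
      using \<open>cmod z = t\<close> \<open>cmod (1 - z) = 1 + t\<close> t by auto
    ultimately show "\<exists>z\<in>UNIV - {0, 1 :: complex}. ereal (ln (1 + t) / t powr \<alpha>)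
        \<le> ereal (ln (cmod (1 - z)) / cmod z powr \<alpha>)"
      by (intro bexI[of _ z]) auto
  qed
qed

section \<open>The exponent 1\<close>

lemma C0_one: "C0 1 = ereal 1"
  unfolding C0_eq_SUP_radius
proof (rule SUP_eqI)
  fix t :: real
  assume "t \<in> {0<..}"
  then show "ereal (ln (1 + t) / t powr 1) \<le> ereal 1"
    using ln_add_one_self_le_self[of t] by simp
next
  fix b :: ereal
  assume b: "\<And>t. t \<in> {0<..} \<Longrightarrow> ereal (ln (1 + t) / t powr 1) \<le> b"
  have "ereal (1 / (1 + t)) \<le> b" if t: "t > 0" for t
  proof -
    have "ln (1 / (1 + t)) \<le> 1 / (1 + t) - 1"
      using t by (intro ln_le_minus_one) simp
    also have "\<dots> = - (t / (1 + t))"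
      using t by (simp add: field_simps)
    finally have "t / (1 + t) \<le> ln (1 + t)"
      using t by (simp add: ln_div)
    then have "1 / (1 + t) \<le> ln (1 + t) / t powr 1"
      using t by (simp add: field_simps)
    then show ?thesis
      using b[of t] t by (meson ereal_less_eq(3) greaterThan_iff order_trans)
  qed
  then have "\<forall>\<^sub>F t in at_right 0. ereal (1 / (1 + t)) \<le> b"
    by (auto intro: eventually_mono[OF eventually_at_right_less])
  moreover have "((\<lambda>t. ereal (1 / (1 + t))) \<longlongrightarrow> ereal 1) (at_right (0::real))"
    by (auto intro!: tendsto_eq_intros)
  ultimately show "ereal 1 \<le> b"
    by (metis tendsto_upperbound trivial_limit_at_right_real)
qed

section \<open>The maximum point and the Lambert function\<close>

lemma lambert_W_in_range:
  assumes "y \<ge> - exp (-1)"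
  shows "lambert_W y \<ge> -1"
  using assms bij_betw_imp_surj_on[OF bij_betw_times_exp]
    the_inv_into_into[OF bij_betw_imp_inj_on[OF bij_betw_times_exp], of y "{-1..}"]
  by (simp add: lambert_W_def)

lemma lambert_W_times_exp:
  assumes "y \<ge> - exp (-1)"
  shows "lambert_W y * exp (lambert_W y) = y"
  using f_the_inv_into_f_bij_betw[OF bij_betw_times_exp, of y] assms
  by (simp add: lambert_W_def)

lemma r_of_argument_gt:
  assumes "0 < \<alpha>" "\<alpha> < 1"
  shows "- (1 / \<alpha>) * exp (- (1 / \<alpha>)) > - exp (-1 :: real)"
proof -
  define s where "s = 1 / \<alpha>"
  have s: "s > 1"
    using assms by (simp add: s_def)
  then have "ln s < s - 1"
    using ln_eq_minus_one[of s] ln_le_minus_one[of s] by fastforce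
  then have "exp (ln s) < exp (s - 1)"
    by (simp only: exp_less_cancel_iff)
  then have "s * exp (- s) < exp (s - 1) * exp (- s)"
    using s by simp
  also have "\<dots> = exp (-1)"
    by (simp flip: exp_add)
  finally show ?thesis
    by (simp add: s_def)
qed

lemma r_of_in_interval:
  assumes "0 < \<alpha>" "\<alpha> < 1"
  shows "r_of \<alpha> \<in> {0<..<\<alpha>}"
proof -
  define y where "y = - (1 / \<alpha>) * exp (- (1 / \<alpha>))"
  define w where "w = lambert_W y"
  have y: "y > - exp (-1)"
    unfolding y_def using r_of_argument_gt[OF assms] .
  have w: "w * exp w = y"
    unfolding w_def using y by (intro lambert_W_times_exp) simp
  have "y < 0"
    using assms by (simp add: y_def)
  then have "w < 0"
    using w by (metis exp_gt_zero mult_nonneg_nonneg not_less less_imp_le)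
  moreover have "w > -1"
  proof -
    have "w \<ge> -1"
      unfolding w_def using y by (intro lambert_W_in_range) simp
    moreover have "w \<noteq> -1"
      using w y by auto
    ultimately show ?thesis by simp
  qed
  moreover have "r_of \<alpha> = - \<alpha> * w"
    by (simp add: r_of_def w_def y_def)
  ultimately show ?thesis
    using assms mult_strict_left_mono[of "-1" w \<alpha>] by (auto simp: mult_pos_neg)
qed

text \<open>The defining equation of the Lambert value, in logarithmic form: it is the condition for a
  critical point of \<open>- ln x * (x / (1 - x)) powr \<alpha>\<close>.\<close>

lemma r_of_equation:
  assumes "0 < \<alpha>" "\<alpha> < 1"
  shows "\<alpha> * ln (r_of \<alpha>) + 1 - r_of \<alpha> = 0"
proof -
  define y where "y = - (1 / \<alpha>) * exp (- (1 / \<alpha>))"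
  define r where "r = r_of \<alpha>"
  have r: "r > 0"
    using r_of_in_interval[OF assms] by (simp add: r_def)
  have W: "lambert_W y = - (r / \<alpha>)"
    using assms by (simp add: r_def r_of_def y_def)
  have "lambert_W y * exp (lambert_W y) = y"
    using r_of_argument_gt[OF assms] by (intro lambert_W_times_exp) (simp add: y_def)
  then have "r * exp (- (r / \<alpha>)) = exp (- (1 / \<alpha>))"
    using assms unfolding W by (simp add: y_def field_simps)
  then have "ln (r * exp (- (r / \<alpha>))) = - (1 / \<alpha>)"
    by simp
  then have "ln r = (r - 1) / \<alpha>"
    using r by (simp add: ln_mult diff_divide_distrib)
  then have "\<alpha> * ln r = r - 1"
    using assms by simp
  then show ?thesis
    by (simp add: r_def)
qed

section \<open>The maximum of the radial quotient\<close>

text \<open>By concavity the function \<open>\<alpha> * ln x + 1 - x\<close> lies below its tangent at \<open>y\<close>, whose slope has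
  the sign of \<open>\<alpha> - y\<close>. Hence the function increases up to \<open>\<alpha>\<close> and decreases from there on, without
  any differentiation.\<close>

lemma ln_minus_id_diff_le:
  fixes \<alpha> x y :: real
  assumes "0 < \<alpha>" "0 < x" "0 < y"
  shows "(\<alpha> * ln x + 1 - x) - (\<alpha> * ln y + 1 - y) \<le> (x - y) * (\<alpha> - y) / y"
proof -
  have "\<alpha> * (ln x - ln y) \<le> \<alpha> * ((x - y) / y)"
    using assms by (intro mult_left_mono ln_diff_le) auto
  then show ?thesis
    using assms by (simp add: field_simps)
qed

lemma critical_function_nonpos:
  fixes \<alpha> r x :: real
  assumes "0 < x" "x \<le> r" "r < \<alpha>" and r: "\<alpha> * ln r + 1 - r = 0"
  shows "\<alpha> * ln x + 1 - x \<le> 0"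
proof -
  have "(x - r) * (\<alpha> - r) / r \<le> 0"
    using assms by (intro divide_nonpos_pos mult_nonpos_nonneg) auto
  then show ?thesis
    using ln_minus_id_diff_le[of \<alpha> x r] assms by linarith
qed

lemma critical_function_nonneg:
  fixes \<alpha> r x :: real
  assumes "0 < r" "r \<le> x" "x \<le> 1" "r < \<alpha>" and r: "\<alpha> * ln r + 1 - r = 0"
  shows "\<alpha> * ln x + 1 - x \<ge> 0"
proof (cases "x \<le> \<alpha>")
  case True
  then have "(r - x) * (\<alpha> - x) / x \<le> 0"
    using assms by (intro divide_nonpos_pos mult_nonpos_nonneg) auto
  then show ?thesis
    using ln_minus_id_diff_le[of \<alpha> r x] assms by linarith
next
  case False
  then have "(1 - x) * (\<alpha> - x) / x \<le> 0"
    using assms by (intro divide_nonpos_pos mult_nonneg_nonpos) auto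
  then show ?thesis
    using ln_minus_id_diff_le[of \<alpha> 1 x] assms by simp
qed

text \<open>The comparison is made for the logarithm of \<open>- ln x * (x / (1 - x)) powr \<alpha>\<close>, because its
  derivative has a sign controlled by the two preceding lemmas.\<close>

lemma log_radial_quotient_le:
  fixes \<alpha> r x :: real
  assumes r: "0 < r" "r < \<alpha>" "r < 1" "\<alpha> * ln r + 1 - r = 0"
    and x: "0 < x" "x < 1"
  shows "ln (- ln x) + \<alpha> * (ln x - ln (1 - x)) \<le> ln (- ln r) + \<alpha> * (ln r - ln (1 - r))"
proof -
  define f where "f = (\<lambda>x. ln (- ln x) + \<alpha> * (ln x - ln (1 - x)))"
  define f' where "f' = (\<lambda>x. (\<alpha> * ln x + 1 - x) / (x * (1 - x) * ln x))"
  have deriv: "(f has_real_derivative f' u) (at u)" if u: "0 < u" "u < 1" for u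
  proof -
    have "ln u < 0"
      using u by simp
    then show ?thesis
      unfolding f_def f'_def using u
      by (auto intro!: derivative_eq_intros simp: field_simps)
  qed
  have denominator: "u * (1 - u) * ln u \<le> 0" if "0 < u" "u < 1" for u :: real
    using that by (intro mult_nonneg_nonpos) auto
  have "f x \<le> f r"
  proof (cases "x \<le> r")
    case True
    show ?thesis
    proof (rule DERIV_nonneg_imp_nondecreasing[OF True])
      fix u assume u: "x \<le> u" "u \<le> r"
      then have "f' u \<ge> 0"
        unfolding f'_def using r x
        by (intro divide_nonpos_nonpos denominator critical_function_nonpos[of u r]) auto
      then show "\<exists>d. (f has_real_derivative d) (at u) \<and> d \<ge> 0"
        using deriv[of u] u r x by auto
    qed
  next
    case False
    then have rx: "r \<le> x" by simp
    show ?thesis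
    proof (rule DERIV_nonpos_imp_nonincreasing[OF rx])
      fix u assume u: "r \<le> u" "u \<le> x"
      then have "f' u \<le> 0"
        unfolding f'_def using r x
        by (intro divide_nonneg_nonpos denominator critical_function_nonneg[of r u]) auto
      then show "\<exists>d. (f has_real_derivative d) (at u) \<and> d \<le> 0"
        using deriv[of u] u r x by auto
    qed
  qed
  then show ?thesis
    by (simp add: f_def)
qed

text \<open>The inverse substitution sends \<open>r\<close> to \<open>t = (1 - r) / r\<close>; there the critical equation
  eliminates the logarithm.\<close>

lemma radial_quotient_at_critical_point:
  fixes \<alpha> r :: real
  assumes r: "0 < r" "r < 1" "\<alpha> * ln r + 1 - r = 0"
  shows "ln (1 + (1 - r) / r) / ((1 - r) / r) powr \<alpha>
    = 1 / \<alpha> * r powr \<alpha> * (1 - r) powr (1 - \<alpha>)"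
proof -
  have "\<alpha> \<noteq> 0"
    using r by auto
  have "1 + (1 - r) / r = 1 / r"
    using r by (simp add: field_simps)
  then have "ln (1 + (1 - r) / r) = (1 - r) / \<alpha>"
    using r \<open>\<alpha> \<noteq> 0\<close> by (simp add: ln_div field_simps)
  then show ?thesis
    using r by (simp add: powr_divide powr_diff)
qed

lemma radial_quotient_le:
  fixes \<alpha> r t :: real
  assumes r: "0 < r" "r < \<alpha>" "r < 1" "\<alpha> * ln r + 1 - r = 0" and t: "0 < t"
  shows "ln (1 + t) / t powr \<alpha> \<le> ln (1 + (1 - r) / r) / ((1 - r) / r) powr \<alpha>"
proof -
  have ln_quotient: "ln (ln (1 + t) / t powr \<alpha>)
      = ln (- ln (1 / (1 + t))) + \<alpha> * (ln (1 / (1 + t)) - ln (1 - 1 / (1 + t)))"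
    if t: "0 < t" for t
  proof -
    have complement: "1 - 1 / (1 + t) = t / (1 + t)"
      using t by (simp add: field_simps)
    show ?thesis
      unfolding complement using t by (simp add: ln_div ln_powr algebra_simps)
  qed
  have pos: "0 < ln (1 + t) / t powr \<alpha>" if "0 < t" for t
    using that by simp
  define s where "s = (1 - r) / r"
  have s: "0 < s" "1 / (1 + s) = r"
    using r by (auto simp: s_def field_simps)
  have "ln (ln (1 + t) / t powr \<alpha>) \<le> ln (ln (1 + s) / s powr \<alpha>)"
    unfolding ln_quotient[OF t] ln_quotient[OF s(1)] s(2)
    using t by (intro log_radial_quotient_le r) auto
  then have "ln (1 + t) / t powr \<alpha> \<le> ln (1 + s) / s powr \<alpha>"
    unfolding ln_le_cancel_iff[OF pos[OF t] pos[OF s(1)]] .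
  then show ?thesis
    unfolding s_def .
qed

theorem theorem2:
  "C0 1 = ereal 1 \<and>
   (\<forall>\<alpha>\<in>{0<..<1}.
      r_of \<alpha> \<in> {0<..<\<alpha>} \<and>
      C0 \<alpha> = ereal (1 / \<alpha> * r_of \<alpha> powr \<alpha> * (1 - r_of \<alpha>) powr (1 - \<alpha>)))"
proof (intro conjI ballI C0_one)
  fix \<alpha> :: real
  assume \<alpha>: "\<alpha> \<in> {0<..<1}"
  then show r_mem: "r_of \<alpha> \<in> {0<..<\<alpha>}"
    by (intro r_of_in_interval) auto
  define r where "r = r_of \<alpha>"
  have r: "0 < r" "r < \<alpha>" "r < 1" "\<alpha> * ln r + 1 - r = 0"
    using r_mem \<alpha> r_of_equation[of \<alpha>] by (auto simp: r_def)
  have "C0 \<alpha> = ereal (ln (1 + (1 - r) / r) / ((1 - r) / r) powr \<alpha>)"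
    unfolding C0_eq_SUP_radius
  proof (rule SUP_eqI)
    fix t :: real
    assume "t \<in> {0<..}"
    then show "ereal (ln (1 + t) / t powr \<alpha>)
        \<le> ereal (ln (1 + (1 - r) / r) / ((1 - r) / r) powr \<alpha>)"
      using radial_quotient_le[OF r] by simp
  next
    fix b :: ereal
    assume "\<And>t. t \<in> {0<..} \<Longrightarrow> ereal (ln (1 + t) / t powr \<alpha>) \<le> b"
    then show "ereal (ln (1 + (1 - r) / r) / ((1 - r) / r) powr \<alpha>) \<le> b"
      using r by simp
  qed
  then show "C0 \<alpha> = ereal (1 / \<alpha> * r_of \<alpha> powr \<alpha> * (1 - r_of \<alpha>) powr (1 - \<alpha>))"
    unfolding radial_quotient_at_critical_point[OF r(1,3,4)] by (simp only: r_def)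
qed

end
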